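(* Let $r>k\ge 2$ and $3\le t\le e-1$ be integers. Let $\mathcal{F}\subseteq\binom{[n]}{r}$ be an $r$-graph on the vertex set $[n]$ such that (a) $\mathcal{F}$ is $\mathscr{G}_r(er-(e-1)k,e)$-free, and is $\mathscr{G}_r(ir-(i-1)k-1,i)$-free for all $t\le i\le e-1$; (b) for every $(k-1)$-subset $T\subseteq[n]$, the number of edges of $\mathcal{F}$ containing $T$ is either $0$ or at least $e$. Suppose that $\mathcal{F}$ is not $\mathscr{G}_r((t-1)r-(t-2)k-1,t-1)$-free, i.e., there are $t-1$ distinct edges $A_1,\ldots,A_{t-1}\in\mathcal{F}$ such that $|\bigcup_{i=1}^{t-1}A_i|\le (t-1)r-(t-2)k-1$. Let $X=\bigcup_{i=1}^{t-1}A_i$. Then the following hold: (i) $|X|=(t-1)r-(t-2)k-1$; (ii) for every $A\in\mathcal{F}\setminus\{A_1,\ldots,A_{t-1}\}$, $|A\cap X|\le k-1$; (iii) let $\mathcal{I}(X)=\{A\in\mathcal{F}\setminus\{A_1,\ldots,A_{t-1}\}:|A\cap X|=k-1\}$; then $$|\mathcal{I}(X)|\le\max\big\{e-t+1,\ f_{r-k+1}\big(n-|X|,\ (e-t+1)(r-k+1)-(e-t),\ e-t+1\big)\big\}.$$ In particular, if $n$ is large enough as a function of $r$ and $e$, then $|\mathcal{I}(X)|<\frac{n-|X|}{r-k}$.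
   Context: $[n]=\{1,\ldots,n\}$ and $\binom{[n]}{r}$ is the set of all $r$-element subsets of $[n]$. For an integer $s\ge 2$, an $s$-graph ($s$-uniform hypergraph) on a vertex set is a family of distinct $s$-element subsets of it, called edges. For positive integers $v,i$, an $s$-graph $\mathcal{H}$ is called $\mathscr{G}_s(v,i)$-free if for arbitrary $i$ distinct edges $B_1,\ldots,B_i\in\mathcal{H}$ one has $|\bigcup_{j=1}^i B_j|\ge v+1$ (vacuously true if $\mathcal{H}$ has fewer than $i$ edges). $f_s(n,v,i)$ denotes the maximum number of edges in an $n$-vertex $\mathscr{G}_s(v,i)$-free $s$-graph; this definition is used here for all $s\ge 2$ and $i\ge 2$. *)

theory Defs
  imports Complex_Main "HOL-Library.Ramsey"
begin

text \<open>
  An \<open>s\<close>-graph on a vertex set \<open>V\<close> is a family \<open>H \<subseteq> nsets V s\<close>, where \<^const>\<open>nsets\<close> is the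
  set of \<open>s\<close>-element subsets from the Ramsey library. A choice of \<open>i\<close> distinct edges of \<open>H\<close> is
  an \<open>i\<close>-element subfamily of \<open>H\<close>.
\<close>

definition G_free :: "nat \<Rightarrow> nat \<Rightarrow> 'a set set \<Rightarrow> bool" where
  "G_free v i H \<longleftrightarrow> (\<forall>B \<in> nsets H i. card (\<Union>B) \<ge> v + 1)"

text \<open>
  The maximum below is over a finite set, which is nonempty for \<open>i \<ge> 1\<close> because the empty
  hypergraph is then vacuously free; for \<open>i = 0\<close> the set is empty and the value is meaningless.
\<close>

definition f_max :: "nat \<Rightarrow> nat \<Rightarrow> nat \<Rightarrow> nat \<Rightarrow> nat" where
  "f_max s n v i = Max (card ` {H. H \<subseteq> nsets {1..n} s \<and> G_free v i H})"

end

theory Submission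
  imports Defs
begin

text \<open>
  Write \<open>r = k + d\<close>. The hypotheses say that \<open>i\<close> edges span at least \<open>i d + k\<close> vertices for
  \<open>t \<le> i < e\<close> and at least \<open>e d + k + 1\<close> for \<open>i = e\<close>, whereas \<open>X\<close> has at most
  \<open>(t - 1) d + k - 1\<close> vertices. Adding to \<open>X\<close> an edge that meets it in \<open>k\<close> vertices contradicts
  the case \<open>i = t\<close>, and so does one that meets it in \<open>k - 1\<close> vertices if \<open>X\<close> is any smaller; the
  degree condition provides such an edge. Hence, with \<open>m = e - t + 1\<close>, the traces \<open>A - X\<close> of \<open>j < m\<close>
  edges of \<open>\<I>(X)\<close> span at least \<open>j d + 1\<close> vertices, and those of \<open>m\<close> edges at least \<open>m d + 2\<close>.
  The bound for two traces makes \<open>A \<mapsto> A - X\<close> injective. A connected family of \<open>c\<close> traces spans at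
  most \<open>c d + 1\<close> vertices, so every component of the trace hypergraph has fewer than \<open>m\<close> edges
  and exactly \<open>c d + 1\<close> vertices, whence \<open>|\<I>(X)| d < n - |X|\<close>.
\<close>

lemma G_freeD:
  assumes "G_free v i H" "B \<subseteq> H" "finite B" "card B = i"
  shows "v < card (\<Union>B)"
proof -
  have "B \<in> nsets H i" using assms by (simp add: nsets_def)
  then show ?thesis using assms(1) by (simp add: G_free_def Suc_le_eq)
qed

lemma G_free_image:
  assumes "inj_on g V" "H \<subseteq> Pow V" "G_free v i H"
  shows "G_free v i ((`) g ` H)"
  unfolding G_free_def
proof
  fix B assume "B \<in> nsets ((`) g ` H) i"
  then have B: "B \<subseteq> (`) g ` H" "finite B" "card B = i"
    by (auto simp: nsets_def)
  then obtain C where C: "C \<subseteq> H" "finite C" "B = (`) g ` C"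
    by (meson finite_subset_image)
  have inj: "inj_on ((`) g) H"
    by (meson assms(1,2) inj_on_image_Pow inj_on_subset)
  then have "card C = i"
    using B(3) C card_image inj_on_subset by metis
  then have "v < card (\<Union>C)"
    using G_freeD[OF assms(3)] C by blast
  moreover have "card (\<Union>B) = card (\<Union>C)"
  proof -
    have "\<Union>B = g ` \<Union>C" using C by blast
    moreover have "inj_on g (\<Union>C)"
      using assms(1,2) C(1) by (meson Sup_le_iff inj_on_subset PowD subsetD)
    ultimately show ?thesis by (simp add: card_image)
  qed
  ultimately show "v + 1 \<le> card (\<Union>B)" by simp
qed

text \<open>\<open>f_max\<close> only ranges over hypergraphs on an initial segment of the naturals.
  A bijection from \<open>V\<close> relabels \<open>H\<close> there, keeping edge sizes and, being
  injective, the sizes of all unions.\<close>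

lemma card_le_f_max:
  assumes "finite V" "H \<subseteq> nsets V s" "G_free v i H"
  shows "card H \<le> f_max s (card V) v i"
proof -
  obtain g where g: "bij_betw g V {1..card V}"
    using assms(1) by (metis card_atLeastAtMost diff_Suc_1 finite_atLeastAtMost finite_same_card_bij)
  then have inj: "inj_on g V" and im: "g ` V = {1..card V}"
    by (auto simp: bij_betw_def)
  have sub: "H \<subseteq> Pow V" using assms(2) by (auto simp: nsets_def)
  let ?S = "{H. H \<subseteq> nsets {1..card V} s \<and> G_free v i H}"
  have "(`) g ` H \<subseteq> nsets {1..card V} s"
  proof
    fix B assume "B \<in> (`) g ` H"
    then obtain A where A: "A \<in> H" "B = g ` A" by blast
    then have "A \<subseteq> V" "finite A" "card A = s" using assms(2) by (auto simp: nsets_def)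
    then show "B \<in> nsets {1..card V} s"
      using A im inj by (auto simp: nsets_def card_image inj_on_subset)
  qed
  then have "(`) g ` H \<in> ?S"
    using G_free_image[OF inj sub assms(3)] by blast
  moreover have "card ((`) g ` H) = card H"
    by (meson card_image inj sub inj_on_image_Pow inj_on_subset)
  ultimately have "card H \<in> card ` ?S"
    by (metis (no_types, lifting) imageI)
  moreover have "finite ?S"
    by (rule finite_subset[of _ "Pow (nsets {1..card V} s)"]) (auto simp: finite_imp_finite_nsets)
  ultimately show ?thesis
    unfolding f_max_def by (simp add: Max_ge)
qed

text \<open>Splits off one connected component \<open>C\<close> at a time, obtained as a maximal subfamily that
  spans at most \<open>|C| d + 1\<close> vertices.\<close>
lemma card_Union_gt_mult_card:
  assumes "finite H" "H \<noteq> {}"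
    and "\<And>A. A \<in> H \<Longrightarrow> card A = d + 1"
    and "0 < m"
    and "\<And>j. 0 < j \<Longrightarrow> j < m \<Longrightarrow> G_free (j * d) j H"
    and "G_free (m * d + 1) m H"
  shows "card H * d < card (\<Union>H)"
  using assms
proof (induction "card H" arbitrary: H rule: less_induct)
  case less
  have fin: "finite A" if "A \<in> H" for A
    using less.prems(3)[OF that] by (metis Suc_eq_plus1 card.infinite nat.distinct(1))
  define P where "P C \<longleftrightarrow> C \<subseteq> H \<and> C \<noteq> {} \<and> card (\<Union>C) \<le> card C * d + 1" for C
  \<comment> \<open>Any \<open>m\<close> edges span at least \<open>m * d + 2\<close> vertices.
    Hence a family that grows edge by edge while keeping \<open>P\<close> never gets past size
    \<open>m - 1\<close>.\<close>
  have notm: "card C \<noteq> m" if "P C" for C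
    using that G_freeD[OF less.prems(6), of C] finite_subset[OF _ less.prems(1)]
    by (auto simp: P_def)
  obtain A where "A \<in> H" using less.prems(2) by blast
  then have "P {A}" using less.prems(3) by (simp add: P_def)
  moreover have "card {A} < m" using notm[OF \<open>P {A}\<close>] less.prems(4) by simp
  ultimately have ex: "P {A} \<and> card {A} < m" by blast
  obtain C where C: "P C" "card C < m" and
    maxC: "\<And>D. P D \<Longrightarrow> card D < m \<Longrightarrow> card D \<le> card C"
    using ex_has_greatest_nat[of "\<lambda>C. P C \<and> card C < m" "{A}" card m] ex by auto
  have CH: "C \<subseteq> H" "C \<noteq> {}" "finite C" "card (\<Union>C) \<le> card C * d + 1"
    using C(1) finite_subset[OF _ less.prems(1)] by (auto simp: P_def)
  have "0 < card C" using CH by (simp add: card_gt_0_iff)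
  have finC: "finite (\<Union>C)" using CH fin by blast
  \<comment> \<open>An edge touching \<open>C\<close> adds at most \<open>d\<close> new vertices, so
    \<open>insert B C\<close> would satisfy \<open>P\<close> again, contradicting either
    \<open>notm\<close> or the maximality of \<open>C\<close>.\<close>
  have disj: "B \<inter> \<Union>C = {}" if B: "B \<in> H - C" for B
  proof (rule ccontr)
    assume ne: "B \<inter> \<Union>C \<noteq> {}"
    have "finite B" using B fin by blast
    then have "1 \<le> card (B \<inter> \<Union>C)" using ne by (simp add: Suc_le_eq card_gt_0_iff)
    then have "card (B \<union> \<Union>C) \<le> d + card (\<Union>C)"
      using card_Un_Int[OF \<open>finite B\<close> finC] less.prems(3)[of B] B by auto
    then have P: "P (insert B C)"
      using CH B by (auto simp: P_def)
    have "card (insert B C) = Suc (card C)" using B CH by simp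
    then show False
      using notm[OF P] maxC[OF P] C(2) by linarith
  qed
  have Cd: "card C * d < card (\<Union>C)"
    using G_freeD[OF less.prems(5)[OF \<open>0 < card C\<close> C(2)]] CH by blast
  show ?case
  proof (cases "H = C")
    case True
    then show ?thesis using Cd by simp
  next
    case False
    then have ne: "H - C \<noteq> {}" using CH by blast
    have free: "G_free v i (H - C)" if "G_free v i H" for v i
      using that by (auto simp: G_free_def nsets_def)
    have c: "card H = card C + card (H - C)"
      using CH less.prems(1) by (metis card_Diff_subset card_mono le_add_diff_inverse)
    have IH: "card (H - C) * d < card (\<Union>(H - C))"
      using less.hyps[OF _ _ ne] less.prems free c \<open>0 < card C\<close> by auto
    have "\<Union>H = \<Union>C \<union> \<Union>(H - C)" using CH by blast
    moreover have "card (\<Union>C \<union> \<Union>(H - C)) = card (\<Union>C) + card (\<Union>(H - C))"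
      using disj less.prems(1) fin finC by (intro card_Un_disjoint) auto
    ultimately show ?thesis using IH Cd c by (simp add: add_mult_distrib)
  qed
qed

text \<open>Writing the edge size as \<open>k + d\<close> replaces the nested truncated subtractions
  in the thresholds by expressions linear in the number of edges, so that spans can be compared by
  arithmetic.\<close>

lemma tight_family_extensions:
  fixes d k t e n :: nat and F \<A> :: "nat set set"
  assumes k: "2 \<le> k" and d: "0 < d" and t: "3 \<le> t" "t < e"
    and F: "F \<subseteq> nsets {1..n} (k + d)"
    and free_e: "G_free (e * d + k) e F"
    and free_i: "\<forall>i. t \<le> i \<and> i < e \<longrightarrow> G_free (i * d + k - 1) i F"
    and deg: "\<forall>T \<in> nsets {1..n} (k - 1).
      card {A \<in> F. T \<subseteq> A} = 0 \<or> card {A \<in> F. T \<subseteq> A} \<ge> e"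
    and \<A>: "\<A> \<in> nsets F (t - 1)"
    and X: "X = \<Union>\<A>" "card X \<le> (t - 1) * d + k - 1"
    and I: "I = {A \<in> F - \<A>. card (A \<inter> X) = k - 1}"
    and m: "m = e - t + 1"
  shows "card X = (t - 1) * d + k - 1"
    and "\<forall>A \<in> F - \<A>. card (A \<inter> X) \<le> k - 1"
    and "card I \<le> f_max (d + 1) (n - card X) (m * d + 1) m"
    and "card X < n \<Longrightarrow> card I * d < n - card X"
proof -
  have sz: "A \<subseteq> {1..n}" "finite A" "card A = k + d" if "A \<in> F" for A
    using F that by (auto simp: nsets_def)
  have \<A>': "\<A> \<subseteq> F" "finite \<A>" "card \<A> = t - 1"
    using \<A> by (auto simp: nsets_def)
  have finF: "finite F"
    using F finite_imp_finite_nsets finite_subset by blast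
  have Xn: "X \<subseteq> {1..n}" using X \<A>' sz by blast
  then have finX: "finite X" using finite_subset by blast
  \<comment> \<open>Together with \<open>\<A>\<close>, the edge \<open>A\<close> gives
    \<open>t\<close> edges, which span at least \<open>t * d + k\<close> vertices;
    inclusion-exclusion then limits the overlap.\<close>
  have small: "card (A \<inter> X) + (t - 1) * d \<le> card X" if A: "A \<in> F - \<A>" for A
  proof -
    have "finite A" "card A = k + d" using A sz by auto
    have "t * d + k - 1 < card (\<Union>(insert A \<A>))"
      using A \<A>' t by (intro G_freeD[OF free_i[rule_format, of t]]) auto
    then have "t * d + k - 1 < card (A \<union> X)" using X(1) by simp
    moreover have "card A + card X = card (A \<union> X) + card (A \<inter> X)"
      using card_Un_Int[OF \<open>finite A\<close> finX] .
    moreover have "t * d = (t - 1) * d + d" using t by (cases t) auto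
    ultimately show ?thesis using \<open>card A = k + d\<close> by linarith
  qed
  show cX: "card X = (t - 1) * d + k - 1"
  proof -
    have "\<A> \<noteq> {}" using \<A>' t by auto
    then obtain A where A: "A \<in> \<A>" by blast
    then have "k - 1 \<le> card A" using \<A>' sz by fastforce
    \<comment> \<open>Since \<open>A\<close> contains \<open>T\<close>, the degree of
      \<open>T\<close> is nonzero, hence at least \<open>e > t - 1\<close>. Some edge outside
      \<open>\<A>\<close> therefore contains \<open>T\<close> and makes \<open>small\<close>
      tight.\<close>
    then obtain T where T: "T \<subseteq> A" "card T = k - 1" "finite T"
      using obtain_subset_with_card_n by metis
    have "A \<in> F" using A \<A>' by blast
    then have Tn: "T \<in> nsets {1..n} (k - 1)" using T sz(1) by (auto simp: nsets_def)
    have "card {A \<in> F. T \<subseteq> A} \<noteq> 0" using finF \<open>A \<in> F\<close> T by auto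
    then have "card \<A> < card {A \<in> F. T \<subseteq> A}" using deg[rule_format, OF Tn] \<A>' t by linarith
    then have "\<not> {A \<in> F. T \<subseteq> A} \<subseteq> \<A>" using \<A>'(2) by (meson card_mono not_le)
    then obtain B where B: "B \<in> F - \<A>" "T \<subseteq> B" by blast
    have "T \<subseteq> B \<inter> X" using B T A X by blast
    then have "k - 1 \<le> card (B \<inter> X)" using T finX by (metis card_mono finite_Int)
    then show ?thesis using small[OF B(1)] X(2) k by linarith
  qed
  show "\<forall>A \<in> F - \<A>. card (A \<inter> X) \<le> k - 1"
  proof
    fix A assume "A \<in> F - \<A>"
    from small[OF this] show "card (A \<inter> X) \<le> k - 1"
      using cX k by linarith
  qed
  have IF: "I \<subseteq> F" "finite I" using I finF by auto
  have span: "card (\<Union>(\<A> \<union> B)) = card X + card (\<Union>((\<lambda>A. A - X) ` B))"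
    "card (\<A> \<union> B) = t - 1 + card B"
    if B: "B \<subseteq> I" for B
  proof -
    have "finite B" using B IF finite_subset by blast
    have "\<Union>(\<A> \<union> B) = X \<union> \<Union>((\<lambda>A. A - X) ` B)" using X by blast
    moreover have "finite (\<Union>((\<lambda>A. A - X) ` B))"
      using \<open>finite B\<close> B IF sz(2) by blast
    moreover have "X \<inter> \<Union>((\<lambda>A. A - X) ` B) = {}" by blast
    ultimately show "card (\<Union>(\<A> \<union> B)) = card X + card (\<Union>((\<lambda>A. A - X) ` B))"
      using finX by (metis card_Un_disjoint)
    have "\<A> \<inter> B = {}" using B I by blast
    then show "card (\<A> \<union> B) = t - 1 + card B"
      using \<A>' \<open>finite B\<close> by (simp add: card_Un_disjoint)
  qed
  \<comment> \<open>For \<open>0 < card B < m\<close> the number of edges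
    \<open>t - 1 + card B\<close> lies between \<open>t\<close> and \<open>e - 1\<close>; for
    \<open>card B = m\<close> it is exactly \<open>e\<close>.\<close>
  have span_j: "card B * d < card (\<Union>((\<lambda>A. A - X) ` B))"
    if B: "B \<subseteq> I" "0 < card B" "card B < m" for B
  proof -
    have fB: "finite (\<A> \<union> B)" "\<A> \<union> B \<subseteq> F"
      using B IF \<A>' finite_subset by auto
    have "(t - 1 + card B) * d + k - 1 < card (\<Union>(\<A> \<union> B))"
      using B m t fB span(2)[OF B(1)]
      by (intro G_freeD[OF free_i[rule_format, of "t - 1 + card B"]]) auto
    then show ?thesis using span(1)[OF B(1)] cX k by (simp add: add_mult_distrib)
  qed
  have span_m: "m * d + 1 < card (\<Union>((\<lambda>A. A - X) ` B))"
    if B: "B \<subseteq> I" "card B = m" for B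
  proof -
    have fB: "finite (\<A> \<union> B)" "\<A> \<union> B \<subseteq> F"
      using B IF \<A>' finite_subset by auto
    have "e * d + k < card (\<Union>(\<A> \<union> B))"
      using B m t fB span(2)[OF B(1)] by (intro G_freeD[OF free_e]) auto
    moreover have "e = t - 1 + m" using m t by simp
    then have "e * d = (t - 1) * d + m * d" by (metis add_mult_distrib)
    ultimately show ?thesis using span(1)[OF B(1)] cX k by linarith
  qed
  have trace: "card (A - X) = d + 1" if "A \<in> I" for A
  proof -
    have "A \<in> F" "card (A \<inter> X) = k - 1" using that I by auto
    then show ?thesis using sz[of A] k by (simp add: card_Diff_subset_Int)
  qed
  have inj: "inj_on (\<lambda>A. A - X) I"
  proof (rule inj_onI, rule ccontr)
    fix A A' assume A: "A \<in> I" "A' \<in> I" "A - X = A' - X" "A \<noteq> A'"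
    then have c: "card {A, A'} = 2" "{A, A'} \<subseteq> I" by auto
    have "2 \<le> m" using m t by simp
    then have "2 * d < card (\<Union>((\<lambda>A. A - X) ` {A, A'}))"
      \<comment> \<open>A pair falls under \<open>span_m\<close> when \<open>m = 2\<close> and under
        \<open>span_j\<close> otherwise; equal traces would span only
        \<open>d + 1 \<le> 2 * d\<close> vertices.\<close>
      using span_j[of "{A, A'}"] span_m[of "{A, A'}"] c by (cases "m = 2") auto
    also have "\<dots> = d + 1" using A trace by simp
    finally show False using d by simp
  qed
  let ?H = "(\<lambda>A. A - X) ` I"
  have cH: "card ?H = card I" using inj by (rule card_image)
  have HV: "?H \<subseteq> nsets ({1..n} - X) (d + 1)"
    using trace IF sz by (fastforce simp: nsets_def)
  have cV: "card ({1..n} - X) = n - card X"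
    using Xn finX by (simp add: card_Diff_subset)
  have free: "G_free v j ?H"
    if "\<And>B. B \<subseteq> I \<Longrightarrow> card B = j \<Longrightarrow> v < card (\<Union>((\<lambda>A. A - X) ` B))" for v j
    unfolding G_free_def
  proof
    fix C assume "C \<in> nsets ?H j"
    then obtain B where B: "B \<subseteq> I" "C = (\<lambda>A. A - X) ` B" "card C = j"
      by (auto simp: nsets_def subset_image_iff)
    then have "card B = j" using inj by (metis card_image inj_on_subset)
    then show "v + 1 \<le> card (\<Union>C)" using that[OF B(1)] B(2) by simp
  qed
  have free_m: "G_free (m * d + 1) m ?H"
    using span_m by (rule free)
  have free_j: "G_free (j * d) j ?H" if "0 < j" "j < m" for j
    using span_j that by (intro free) blast
  show "card I \<le> f_max (d + 1) (n - card X) (m * d + 1) m"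
    using card_le_f_max[OF _ HV free_m] cH cV by simp
  show "card I * d < n - card X" if "card X < n"
  proof (cases "I = {}")
    case True
    then show ?thesis using that by simp
  next
    case False
    have "card ?H * d < card (\<Union>?H)"
      using False IF trace m t
      by (intro card_Union_gt_mult_card[where m = m] free_m free_j) auto
    also have "\<dots> \<le> card ({1..n} - X)"
      using IF sz(1) by (intro card_mono) auto
    finally show ?thesis using cH cV by simp
  qed
qed

theorem lemma9:
  fixes r e :: nat
  shows "\<exists>N::nat. \<forall>(k::nat) (t::nat) (n::nat) (F::nat set set) (\<A>::nat set set).
    2 \<le> k \<longrightarrow> k < r \<longrightarrow> 3 \<le> t \<longrightarrow> t \<le> e - 1 \<longrightarrow>
    F \<subseteq> nsets {1..n} r \<longrightarrow>
    G_free (e * r - (e - 1) * k) e F \<longrightarrow>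
    (\<forall>i. t \<le> i \<and> i \<le> e - 1 \<longrightarrow> G_free (i * r - (i - 1) * k - 1) i F) \<longrightarrow>
    (\<forall>T \<in> nsets {1..n} (k - 1). card {A \<in> F. T \<subseteq> A} = 0 \<or> card {A \<in> F. T \<subseteq> A} \<ge> e) \<longrightarrow>
    \<A> \<in> nsets F (t - 1) \<longrightarrow>
    card (\<Union>\<A>) \<le> (t - 1) * r - (t - 2) * k - 1 \<longrightarrow>
    (let X = \<Union>\<A>; I = {A \<in> F - \<A>. card (A \<inter> X) = k - 1} in
      card X = (t - 1) * r - (t - 2) * k - 1 \<and>
      (\<forall>A \<in> F - \<A>. card (A \<inter> X) \<le> k - 1) \<and>
      card I \<le> max (e - t + 1)
        (f_max (r - k + 1) (n - card X) ((e - t + 1) * (r - k + 1) - (e - t)) (e - t + 1)) \<and>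
      (N \<le> n \<longrightarrow> real (card I) < (real n - real (card X)) / (real r - real k)))"
proof (intro exI[of _ "e * r + 1"] allI impI, goal_cases)
  case (1 k t n F \<A>)
  define d where "d = r - k"
  define m where "m = e - t + 1"
  define X where "X = \<Union>\<A>"
  define I where "I = {A \<in> F - \<A>. card (A \<inter> X) = k - 1}"
  have r: "r = k + d" "0 < d" using 1(2) d_def by auto
  have te: "t < e" using 1(3,4) by auto
  have exp: "i * r - (i - 1) * k = i * d + k" if "0 < i" for i
    using that r by (cases i) (auto simp: algebra_simps)
  have bound: "(t - 1) * r - (t - 2) * k - 1 = (t - 1) * d + k - 1"
    using exp[of "t - 1"] 1(3) by (simp add: numeral_2_eq_2)
  have mbound: "(e - t + 1) * (r - k + 1) - (e - t) = m * d + 1"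
    by (simp add: m_def d_def algebra_simps)
  note aux = tight_family_extensions[OF 1(1) r(2) 1(3) te _ _ _ _ 1(9) X_def _ I_def m_def, of n]
  have prems: "F \<subseteq> nsets {1..n} (k + d)" "G_free (e * d + k) e F"
    "\<forall>i. t \<le> i \<and> i < e \<longrightarrow> G_free (i * d + k - 1) i F"
    "\<forall>T \<in> nsets {1..n} (k - 1).
      card {A \<in> F. T \<subseteq> A} = 0 \<or> card {A \<in> F. T \<subseteq> A} \<ge> e"
    "card X \<le> (t - 1) * d + k - 1"
  proof -
    show "\<forall>i. t \<le> i \<and> i < e \<longrightarrow> G_free (i * d + k - 1) i F"
    proof (intro allI impI)
      fix i assume i: "t \<le> i \<and> i < e"
      then have "G_free (i * r - (i - 1) * k - 1) i F"
        using 1(7)[rule_format, of i] by linarith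
      moreover have "0 < i" using i 1(3) by linarith
      ultimately show "G_free (i * d + k - 1) i F" by (simp only: exp)
    qed
  qed (use 1 r te exp[of e] bound X_def in auto)
  note concl = aux[OF prems]
  have "real (card I) < (real n - real (card X)) / (real r - real k)" if n: "e * r + 1 \<le> n"
  proof -
    \<comment> \<open>This explains the witness \<open>e * r + 1\<close>: it exceeds
      \<open>card X\<close> for every admissible \<open>t\<close> and \<open>k\<close>, so a vertex
      outside \<open>X\<close> remains.\<close>
    have "card X \<le> (t - 1) * r" using concl(1) bound diff_le_self by (metis le_trans)
    also have "\<dots> \<le> e * r" using te by (intro mult_le_mono1) simp
    finally have "card X < n" using n by simp
    then have "card I * d < n - card X" by (rule concl(4))
    then have "real (card I * d + card X) < real n" by linarith
    then show ?thesis using r by (simp add: field_simps)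
  qed
  then show ?case
    using concl(1-3) unfolding Let_def bound mbound X_def[symmetric] I_def[symmetric]
    by (auto simp: d_def m_def le_max_iff_disj)
qed

end
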